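(* Let $\mathbb{E}$ be a field, and let $\mathbb{E}:\mathbb{F}$ be a finite Galois extension with Galois group $G$. Let $d\ge 1$ and let $C\colon G\to \mathrm{GL}_d(\mathbb{E})$, $\alpha\mapsto C_\alpha$, be a 1-cocycle, i.e. $C_{\alpha\beta}=C_\alpha\,\alpha(C_\beta)$ for all $\alpha,\beta\in G$. Suppose that $|\mathbb{F}|\ge d$ (this holds automatically if $\mathbb{F}$ is infinite). Then there exists $\lambda\in\mathbb{E}$ such that the matrix $$\Pi_C(I\lambda)=\sum_{\alpha\in G} C_\alpha\,\alpha(\lambda)$$ is invertible.
   Context: An automorphism $\alpha$ of $\mathbb{E}$ acts on matrices over $\mathbb{E}$ entrywise: $\alpha((\mu_{i,j}))=(\alpha(\mu_{i,j}))$. Automorphisms act on the left, and $\alpha\beta$ denotes the composite $\alpha\circ\beta$. For $X\in\mathbb{E}^{d\times d}$, $\Pi_C(X)=\sum_{\alpha\in G}C_\alpha\,\alpha(X)$, and $I\lambda$ denotes the scalar matrix with $\lambda$ on the diagonal. *)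

theory Defs
  imports "HOL-Analysis.Analysis"
begin

text \<open>
  The big field is the whole type \<open>'e\<close>; the small field is a subset of it.
\<close>

definition is_subfield :: "'e::field set \<Rightarrow> bool" where
  "is_subfield F \<longleftrightarrow>
     0 \<in> F \<and> 1 \<in> F \<and>
     (\<forall>x\<in>F. \<forall>y\<in>F. x + y \<in> F \<and> x * y \<in> F) \<and>
     (\<forall>x\<in>F. - x \<in> F \<and> inverse x \<in> F)"

definition finite_extension :: "'e::field set \<Rightarrow> bool" where
  "finite_extension F \<longleftrightarrow> is_subfield F \<and>
     (\<exists>B. finite B \<and> (\<forall>x. \<exists>c. (\<forall>b\<in>B. c b \<in> F) \<and> x = (\<Sum>b\<in>B. c b * b)))"

definition field_automorphism :: "('e::field \<Rightarrow> 'e) \<Rightarrow> bool" where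
  "field_automorphism \<alpha> \<longleftrightarrow> bij \<alpha> \<and> \<alpha> 1 = 1 \<and>
     (\<forall>x y. \<alpha> (x + y) = \<alpha> x + \<alpha> y) \<and>
     (\<forall>x y. \<alpha> (x * y) = \<alpha> x * \<alpha> y)"

definition Gal :: "'e::field set \<Rightarrow> ('e \<Rightarrow> 'e) set" where
  "Gal F = {\<alpha>. field_automorphism \<alpha> \<and> (\<forall>x\<in>F. \<alpha> x = x)}"

text \<open>
  A finite extension is Galois when the base field is exactly the fixed field
  of its automorphism group.
\<close>

definition finite_galois_extension :: "'e::field set \<Rightarrow> bool" where
  "finite_galois_extension F \<longleftrightarrow>
     finite_extension F \<and> {x. \<forall>\<alpha>\<in>Gal F. \<alpha> x = x} = F"

text \<open>
  Cocycles and the map \<open>\<Pi>\<^sub>C\<close> only use the values of \<open>C\<close> on \<open>G\<close>;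
  the values elsewhere are irrelevant.
\<close>

definition one_cocycle :: "('e::field \<Rightarrow> 'e) set \<Rightarrow> (('e \<Rightarrow> 'e) \<Rightarrow> 'e^'d^'d) \<Rightarrow> bool" where
  "one_cocycle G C \<longleftrightarrow>
     (\<forall>\<alpha>\<in>G. invertible (C \<alpha>)) \<and>
     (\<forall>\<alpha>\<in>G. \<forall>\<beta>\<in>G. C (\<alpha> \<circ> \<beta>) = C \<alpha> ** map_matrix \<alpha> (C \<beta>))"

definition Pi_map ::
  "('e::field \<Rightarrow> 'e) set \<Rightarrow> (('e \<Rightarrow> 'e) \<Rightarrow> 'e^'d^'d) \<Rightarrow> 'e^'d^'d \<Rightarrow> 'e^'d^'d" where
  "Pi_map G C X = (\<Sum>\<alpha>\<in>G. C \<alpha> ** map_matrix \<alpha> X)"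

lemma Pi_map_scalar:
  fixes C :: "('e::field \<Rightarrow> 'e) \<Rightarrow> 'e^'d^'d"
  assumes "G \<subseteq> Gal F"
  shows "Pi_map G C (mat l) = (\<Sum>\<alpha>\<in>G. \<chi> i j. C \<alpha> $ i $ j * \<alpha> l)"
  unfolding Pi_map_def
proof (rule sum.cong[OF refl])
  fix \<alpha> assume "\<alpha> \<in> G"
  then have "field_automorphism \<alpha>" using assms by (auto simp: Gal_def)
  then have "\<alpha> (0 + 0) = \<alpha> 0 + \<alpha> 0" unfolding field_automorphism_def by blast
  then have z: "\<alpha> 0 = 0" by (metis add_0 add_right_cancel)
  show "C \<alpha> ** map_matrix \<alpha> (mat l) = (\<chi> i j. C \<alpha> $ i $ j * \<alpha> l)"
    by (simp add: vec_eq_iff matrix_matrix_mult_def mat_def z if_distrib sum.delta cong: if_cong)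
qed

end

theory Submission
  imports Defs "HOL-Computational_Algebra.Polynomial" "HOL-Library.Function_Algebras"
begin

text \<open>
  For \<open>\<lambda> = \<Sum>\<^sub>k x\<^sub>k b\<^sub>k\<close> with \<open>x\<^sub>k \<in> F\<close>, the matrix \<open>\<Pi>\<^sub>C(I\<lambda>)\<close> equals \<open>\<Sum>\<^sub>k x\<^sub>k A\<^sub>k\<close> with
  \<open>A\<^sub>k = \<Pi>\<^sub>C(I b\<^sub>k)\<close>. By Dedekind's independence of automorphisms one can choose \<open>b\<^sub>k\<close> and
  \<open>c\<^sub>k\<close> in the big field such that \<open>\<Sum>\<^sub>k c\<^sub>k \<alpha>(b\<^sub>k)\<close> is \<open>1\<close> for \<open>\<alpha> = id\<close> and \<open>0\<close> for every other
  \<open>\<alpha> \<in> G\<close>; then \<open>\<Sum>\<^sub>k c\<^sub>k A\<^sub>k = C\<^sub>i\<^sub>d\<close> is invertible. The coefficients \<open>c\<^sub>k\<close> are moved into \<open>F\<close>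
  one at a time: a nonzero binary form \<open>det (x A + y R)\<close> of degree \<open>d\<close> has at most \<open>d\<close> zeros
  on the projective line, which has more than \<open>d\<close> points over \<open>F\<close>.
\<close>

subsection \<open>Field automorphisms\<close>

lemma
  assumes "field_automorphism \<alpha>"
  shows field_automorphism_add: "\<alpha> (x + y) = \<alpha> x + \<alpha> y"
    and field_automorphism_mult: "\<alpha> (x * y) = \<alpha> x * \<alpha> y"
    and field_automorphism_zero: "\<alpha> 0 = 0"
proof -
  show add: "\<alpha> (x + y) = \<alpha> x + \<alpha> y" for x y
    using assms by (simp add: field_automorphism_def)
  show "\<alpha> (x * y) = \<alpha> x * \<alpha> y"
    using assms by (simp add: field_automorphism_def)
  show "\<alpha> 0 = 0"
    using add[of 0 0] by (metis add_0 add_cancel_left_left)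
qed

lemma field_automorphism_sum:
  assumes "field_automorphism \<alpha>"
  shows "\<alpha> (\<Sum>k\<in>K. f k) = (\<Sum>k\<in>K. \<alpha> (f k))"
  using assms
  by (induction K rule: infinite_finite_induct)
     (simp_all add: field_automorphism_add field_automorphism_zero)

lemma Gal_automorphism: "\<alpha> \<in> Gal F \<Longrightarrow> field_automorphism \<alpha>"
  by (simp add: Gal_def)

lemma Gal_linear_combination:
  assumes "\<alpha> \<in> Gal F" "\<And>k. k \<in> K \<Longrightarrow> c k \<in> F"
  shows "\<alpha> (\<Sum>k\<in>K. c k * b k) = (\<Sum>k\<in>K. c k * \<alpha> (b k))"
  using assms
  by (auto simp: Gal_def field_automorphism_sum field_automorphism_mult intro!: sum.cong)

lemma id_in_Gal: "id \<in> Gal F"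
  by (simp add: Gal_def field_automorphism_def)

text \<open>
  A constructive form of Dedekind's independence theorem. If \<open>\<beta> y \<noteq> \<alpha> y\<close>, replacing a
  functional \<open>T\<close> by \<open>\<gamma> \<mapsto> (\<gamma> y - \<beta> y) T(\<gamma>)\<close> makes it vanish at \<open>\<beta>\<close> but not at \<open>\<alpha>\<close>.
\<close>

lemma separating_functional_list:
  fixes \<alpha> :: "'e::field \<Rightarrow> 'e"
  assumes "finite S" "\<forall>\<beta>\<in>S. field_automorphism \<beta>" "field_automorphism \<alpha>" "\<alpha> \<notin> S"
  shows "\<exists>xs. (\<forall>\<beta>\<in>S. (\<Sum>(c, b)\<leftarrow>xs. c * \<beta> b) = 0) \<and> (\<Sum>(c, b)\<leftarrow>xs. c * \<alpha> b) = 1"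
  using assms
proof (induction S rule: finite_induct)
  case empty
  have "(\<Sum>(c, b)\<leftarrow>[(1, 1)]. c * \<alpha> b) = 1"
    using empty by (simp add: field_automorphism_def)
  then show ?case by blast
next
  case (insert \<beta> S)
  then obtain xs where xs: "\<And>\<gamma>. \<gamma> \<in> S \<Longrightarrow> (\<Sum>(c, b)\<leftarrow>xs. c * \<gamma> b) = 0"
    "(\<Sum>(c, b)\<leftarrow>xs. c * \<alpha> b) = 1"
    by auto
  have "\<alpha> \<noteq> \<beta>" using insert.prems by auto
  then obtain y where y: "\<alpha> y \<noteq> \<beta> y" by blast
  \<comment> \<open>With T the functional given by \<open>xs\<close>, the two halves of
    \<open>ys\<close> contribute \<open>r * \<gamma> y\<close> and \<open>- r * \<beta> y\<close>
    times T(\<gamma>). The factor \<open>r\<close> keeps the value at \<alpha> equal to 1.\<close>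
  define r where "r = inverse (\<alpha> y - \<beta> y)"
  define ys where "ys = map (\<lambda>(c, b). (r * c, b * y)) xs @ map (\<lambda>(c, b). (- r * \<beta> y * c, b)) xs"
  have ys: "(\<Sum>(c, b)\<leftarrow>ys. c * \<gamma> b) = r * (\<gamma> y - \<beta> y) * (\<Sum>(c, b)\<leftarrow>xs. c * \<gamma> b)"
    if "field_automorphism \<gamma>" for \<gamma>
  proof -
    have "(\<Sum>(c, b)\<leftarrow>map (\<lambda>(c, b). (r * c, b * y)) zs. c * \<gamma> b)
        = r * \<gamma> y * (\<Sum>(c, b)\<leftarrow>zs. c * \<gamma> b)" for zs
      by (induction zs) (auto simp: field_automorphism_mult[OF that] algebra_simps)
    moreover have "(\<Sum>(c, b)\<leftarrow>map (\<lambda>(c, b). (- r * \<beta> y * c, b)) zs. c * \<gamma> b)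
        = - r * \<beta> y * (\<Sum>(c, b)\<leftarrow>zs. c * \<gamma> b)" for zs
      by (induction zs) (auto simp: algebra_simps)
    ultimately show ?thesis
      unfolding ys_def map_append sum_list_append by (simp add: algebra_simps)
  qed
  have "\<forall>\<gamma>\<in>insert \<beta> S. (\<Sum>(c, b)\<leftarrow>ys. c * \<gamma> b) = 0"
    using insert.prems ys xs by auto
  moreover have "(\<Sum>(c, b)\<leftarrow>ys. c * \<alpha> b) = 1"
    using insert.prems ys xs y by (simp add: r_def)
  ultimately show ?case by blast
qed

lemma separating_functional:
  fixes \<alpha> :: "'e::field \<Rightarrow> 'e"
  assumes "finite S" "\<And>\<beta>. \<beta> \<in> S \<Longrightarrow> field_automorphism \<beta>" "\<alpha> \<in> S"
  obtains n :: nat and c b where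
    "\<And>\<beta>. \<beta> \<in> S \<Longrightarrow> (\<Sum>k<n. c k * \<beta> (b k)) = (if \<beta> = \<alpha> then 1 else 0)"
proof -
  obtain xs where xs: "\<And>\<beta>. \<beta> \<in> S - {\<alpha>} \<Longrightarrow> (\<Sum>(c, b)\<leftarrow>xs. c * \<beta> b) = 0"
    "(\<Sum>(c, b)\<leftarrow>xs. c * \<alpha> b) = 1"
    using separating_functional_list[of "S - {\<alpha>}" \<alpha>] assms by auto
  have "(\<Sum>(c, b)\<leftarrow>xs. c * \<beta> b) = (\<Sum>k<length xs. fst (xs ! k) * \<beta> (snd (xs ! k)))" for \<beta>
    by (simp add: sum_list_sum_nth atLeast0LessThan case_prod_beta)
  then show ?thesis
    using xs that[of "\<lambda>k. fst (xs ! k)" "\<lambda>k. snd (xs ! k)" "length xs"] by auto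
qed

text \<open>Restricted to a finite spanning set \<open>B\<close>, distinct automorphisms stay
  distinct and are linearly independent over the big field. This bounds every finite subset of
  \<open>Gal F\<close> by \<open>card B\<close>.\<close>

lemma finite_Gal:
  fixes F :: "'e::field set"
  assumes "finite_extension F"
  shows "finite (Gal F)"
proof -
  obtain B where "finite B"
    and B: "\<And>x. \<exists>c. (\<forall>b\<in>B. c b \<in> F) \<and> x = (\<Sum>b\<in>B. c b * b)"
    using assms by (auto simp: finite_extension_def)
  interpret vs: vector_space "\<lambda>c (f :: 'e \<Rightarrow> 'e) x. c * f x"
    by unfold_locales (auto simp: algebra_simps)
  \<comment> \<open>The value 0 off \<open>B\<close> puts \<open>v \<alpha>\<close> in the span of
    the finitely many indicator functions \<open>e b\<close>.\<close>
  define v where "v \<alpha> = (\<lambda>b. if b \<in> B then \<alpha> b else 0)" for \<alpha> :: "'e \<Rightarrow> 'e"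
  define e where "e b = (\<lambda>b'. if b' = b then 1 else 0 :: 'e)" for b :: 'e
  have sum_fun: "(\<Sum>k\<in>K. g k) x = (\<Sum>k\<in>K. g k x)" for K x and g :: "'k \<Rightarrow> 'e \<Rightarrow> 'e"
    by (induction K rule: infinite_finite_induct) auto
  have v_span: "v \<alpha> \<in> vs.span (e ` B)" for \<alpha>
  proof -
    have "v \<alpha> = (\<Sum>b\<in>B. (\<lambda>x. \<alpha> b * e b x))"
    proof
      fix x
      have "(\<Sum>b\<in>B. (\<lambda>x. \<alpha> b * e b x)) x = (\<Sum>b\<in>B. if x = b then \<alpha> b else 0)"
        unfolding sum_fun by (intro sum.cong) (auto simp: e_def)
      then show "v \<alpha> x = (\<Sum>b\<in>B. (\<lambda>x. \<alpha> b * e b x)) x"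
        using \<open>finite B\<close> by (simp add: v_def)
    qed
    then show ?thesis
      by (simp only:) (intro vs.span_sum vs.span_scale vs.span_base imageI)
  qed
  have inj: "inj_on v (Gal F)"
  proof (rule inj_onI)
    fix \<alpha> \<beta> assume *: "\<alpha> \<in> Gal F" "\<beta> \<in> Gal F" "v \<alpha> = v \<beta>"
    have eq: "\<alpha> b = \<beta> b" if "b \<in> B" for b
      using fun_cong[OF *(3), of b] that by (simp add: v_def)
    show "\<alpha> = \<beta>"
    proof
      fix x
      obtain c where c: "\<And>b. b \<in> B \<Longrightarrow> c b \<in> F" "x = (\<Sum>b\<in>B. c b * b)"
        using B by blast
      show "\<alpha> x = \<beta> x"
        unfolding c(2)
        by (subst (1 2) Gal_linear_combination[of _ F]) (use * c(1) eq in auto)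
    qed
  qed
  have "card S \<le> card B" if S: "S \<subseteq> Gal F" "finite S" for S
  proof -
    have "\<not> vs.dependent (v ` S)"
    proof
      assume "vs.dependent (v ` S)"
      then obtain u \<alpha> where \<alpha>: "\<alpha> \<in> S" "u (v \<alpha>) \<noteq> 0"
        and u: "(\<Sum>f\<in>v ` S. (\<lambda>x. u f * f x)) = 0"
        using S(2) by (auto simp: vs.dependent_finite)
      have inj_S: "inj_on v S" using inj S(1) inj_on_subset by blast
      have uB: "(\<Sum>\<beta>\<in>S. u (v \<beta>) * \<beta> b) = 0" if "b \<in> B" for b
        using fun_cong[OF u, of b] that
        unfolding sum_fun sum.reindex[OF inj_S] by (simp add: v_def)
      \<comment> \<open>Automorphisms in \<open>Gal F\<close> are F-linear, so a relation valid on
        \<open>B\<close> holds everywhere.\<close>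
      have uall: "(\<Sum>\<beta>\<in>S. u (v \<beta>) * \<beta> x) = 0" for x
      proof -
        obtain c where c: "\<And>b. b \<in> B \<Longrightarrow> c b \<in> F" "x = (\<Sum>b\<in>B. c b * b)"
          using B by blast
        have "(\<Sum>\<beta>\<in>S. u (v \<beta>) * \<beta> x) = (\<Sum>\<beta>\<in>S. u (v \<beta>) * (\<Sum>b\<in>B. c b * \<beta> b))"
        proof (rule sum.cong[OF refl])
          fix \<beta> assume "\<beta> \<in> S"
          then show "u (v \<beta>) * \<beta> x = u (v \<beta>) * (\<Sum>b\<in>B. c b * \<beta> b)"
            unfolding c(2) by (subst Gal_linear_combination[of _ F]) (use S(1) c(1) in auto)
        qed
        also have "\<dots> = (\<Sum>\<beta>\<in>S. \<Sum>b\<in>B. c b * (u (v \<beta>) * \<beta> b))"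
          by (simp add: sum_distrib_left mult_ac)
        also have "\<dots> = (\<Sum>b\<in>B. c b * (\<Sum>\<beta>\<in>S. u (v \<beta>) * \<beta> b))"
          by (subst sum.swap) (simp add: sum_distrib_left)
        finally show ?thesis using uB by simp
      qed
      \<comment> \<open>Applied to the relation \<open>uall\<close>, a functional separating
        \<alpha> from the rest of \<open>S\<close> leaves only
        \<open>u (v \<alpha>)\<close>.\<close>
      obtain n :: nat and c b where cb:
        "\<And>\<beta>. \<beta> \<in> S \<Longrightarrow> (\<Sum>k<n. c k * \<beta> (b k)) = (if \<beta> = \<alpha> then 1 else 0)"
        by (rule separating_functional[OF S(2) Gal_automorphism \<alpha>(1)]) (use S(1) in blast)+
      have "u (v \<alpha>) = (\<Sum>\<beta>\<in>S. if \<beta> = \<alpha> then u (v \<beta>) else 0)"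
        using \<alpha>(1) S(2) by simp
      also have "\<dots> = (\<Sum>\<beta>\<in>S. u (v \<beta>) * (\<Sum>k<n. c k * \<beta> (b k)))"
        by (intro sum.cong) (auto simp: cb)
      also have "\<dots> = (\<Sum>\<beta>\<in>S. \<Sum>k<n. c k * (u (v \<beta>) * \<beta> (b k)))"
        by (simp add: sum_distrib_left mult_ac)
      also have "\<dots> = (\<Sum>k<n. c k * (\<Sum>\<beta>\<in>S. u (v \<beta>) * \<beta> (b k)))"
        by (subst sum.swap) (simp add: sum_distrib_left)
      also have "\<dots> = 0" by (simp add: uall)
      finally show False using \<alpha>(2) by simp
    qed
    then have "card (v ` S) \<le> card (e ` B)"
      using vs.independent_span_bound[of "e ` B" "v ` S"] v_span \<open>finite B\<close> by auto
    moreover have "card (v ` S) = card S"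
      using inj S(1) by (intro card_image) (rule inj_on_subset)
    ultimately show ?thesis
      using card_image_le[OF \<open>finite B\<close>, of e] by simp
  qed
  then show ?thesis
    using finite_if_finite_subsets_card_bdd by blast
qed

subsection \<open>Determinants of matrix pencils\<close>

text \<open>Both claims share one induction: the degree bound kills the contribution of
  \<open>r i\<close> to the new top coefficient.\<close>

lemma
  fixes a r :: "'k \<Rightarrow> 'a::comm_ring_1"
  assumes "finite I"
  shows degree_prod_linear_le: "degree (\<Prod>i\<in>I. [:r i, a i:]) \<le> card I"
    and coeff_prod_linear: "coeff (\<Prod>i\<in>I. [:r i, a i:]) (card I) = (\<Prod>i\<in>I. a i)"
proof -
  have "degree (\<Prod>i\<in>I. [:r i, a i:]) \<le> card I \<and>
      coeff (\<Prod>i\<in>I. [:r i, a i:]) (card I) = (\<Prod>i\<in>I. a i)"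
    using assms
  proof (induction I rule: finite_induct)
    case (insert i I)
    let ?p = "\<Prod>i\<in>I. [:r i, a i:]"
    have "degree ([:r i, a i:] * ?p) \<le> degree [:r i, a i:] + degree ?p"
      by (rule degree_mult_le)
    also have "\<dots> \<le> 1 + card I"
      using insert.IH by (intro add_mono) auto
    finally have "degree ([:r i, a i:] * ?p) \<le> 1 + card I" .
    moreover have "coeff ?p (Suc (card I)) = 0"
      using insert.IH by (intro coeff_eq_0) auto
    ultimately show ?case
      using insert by simp
  qed simp
  then show "degree (\<Prod>i\<in>I. [:r i, a i:]) \<le> card I"
    "coeff (\<Prod>i\<in>I. [:r i, a i:]) (card I) = (\<Prod>i\<in>I. a i)" by auto
qed

text \<open>The binary form det(xA + yR) dehomogenised at y = 1; its value at infinity,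
  \<open>det A\<close>, survives as the coefficient at \<open>CARD('d)\<close>.\<close>

definition pencil_poly :: "'e::field^'d^'d \<Rightarrow> 'e^'d^'d \<Rightarrow> 'e poly" where
  "pencil_poly A R = det (\<chi> i j. [:R $ i $ j, A $ i $ j:])"

lemma poly_pencil_poly:
  "poly (pencil_poly A R) x = det (\<chi> i j. x * A $ i $ j + R $ i $ j)"
  by (auto simp: pencil_poly_def det_def poly_sum poly_prod add.commute intro!: sum.cong)

lemma sign_mult_eq_smult: "of_int (sign p) * q = smult (of_int (sign p)) (q :: 'e::field poly)"
  by (simp add: sign_def)

lemma degree_pencil_poly: "degree (pencil_poly A R) \<le> CARD('d)"
  for A R :: "'e::field^'d^'d"
  unfolding pencil_poly_def det_def sign_mult_eq_smult
  by (intro degree_sum_le order_trans[OF degree_smult_le])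
     (auto intro: degree_prod_linear_le)

lemma coeff_pencil_poly: "coeff (pencil_poly A R) CARD('d) = det A"
  for A R :: "'e::field^'d^'d"
  unfolding pencil_poly_def det_def sign_mult_eq_smult
  by (simp add: coeff_sum coeff_prod_linear)

text \<open>Either the point at infinity x = 1, y = 0 works, or \<open>det A = 0\<close> lowers the
  degree below \<open>CARD('d)\<close>, so the roots cannot exhaust \<open>F\<close>.\<close>

lemma pencil_det_nonzero_in_subset:
  fixes A R :: "'e::field^'d^'d"
  assumes F: "0 \<in> F" "1 \<in> F" "infinite F \<or> CARD('d) \<le> card F"
    and det: "det (\<chi> i j. s * A $ i $ j + R $ i $ j) \<noteq> 0"
  shows "\<exists>x\<in>F. \<exists>y\<in>F. det (\<chi> i j. x * A $ i $ j + y * R $ i $ j) \<noteq> 0"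
proof (cases "det A = 0")
  case False
  then show ?thesis
    using F by (intro bexI[of _ 1] bexI[of _ 0]) (simp_all)
next
  case True
  let ?p = "pencil_poly A R"
  \<comment> \<open>The point \<open>s\<close> may lie outside \<open>F\<close>; it only certifies a
    nonzero polynomial.\<close>
  have "?p \<noteq> 0" using det poly_pencil_poly[of A R s] by auto
  then have fin: "finite {x. poly ?p x = 0}" and "card {x. poly ?p x = 0} \<le> degree ?p"
    by (simp_all add: poly_roots_finite card_poly_roots_bound)
  moreover have "degree ?p \<noteq> CARD('d)"
    using True \<open>?p \<noteq> 0\<close> coeff_pencil_poly[of A R] by (metis leading_coeff_0_iff)
  ultimately have less: "card {x. poly ?p x = 0} < CARD('d)"
    using degree_pencil_poly[of A R] by linarith
  have "\<not> F \<subseteq> {x. poly ?p x = 0}"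
  proof
    assume "F \<subseteq> {x. poly ?p x = 0}"
    with fin have "finite F" "card F \<le> card {x. poly ?p x = 0}"
      by (auto intro: finite_subset card_mono)
    with less F(3) show False by simp
  qed
  then obtain x where "x \<in> F" "poly ?p x \<noteq> 0" by blast
  then show ?thesis
    using F(2) by (intro bexI[of _ x] bexI[of _ 1]) (simp_all add: poly_pencil_poly)
qed

text \<open>
  The summand \<open>R\<close> holds the terms whose coefficients are still outside \<open>F\<close>. It must be allowed to
  be rescaled by \<open>y\<close>, as the good point of the projective line may be at infinity.
\<close>

lemma det_combination_nonzero_in_subfield:
  fixes A :: "'k \<Rightarrow> 'e::field^'d^'d" and R :: "'e^'d^'d"
  assumes F: "is_subfield F" "infinite F \<or> CARD('d) \<le> card F"
    and "finite K"
    and "det (\<chi> i j. R $ i $ j + (\<Sum>k\<in>K. c k * A k $ i $ j)) \<noteq> 0"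
  shows "\<exists>y\<in>F. \<exists>x. (\<forall>k\<in>K. x k \<in> F) \<and>
           det (\<chi> i j. y * R $ i $ j + (\<Sum>k\<in>K. x k * A k $ i $ j)) \<noteq> 0"
  using assms(3,4)
proof (induction K arbitrary: R rule: finite_induct)
  case empty
  then show ?case
    using F(1) by (intro bexI[of _ 1]) (auto simp: is_subfield_def)
next
  case (insert k K)
  \<comment> \<open>The term at \<open>k\<close> keeps its old coefficient and joins the remainder
    while \<open>K\<close> is treated.\<close>
  define R' where "R' = (\<chi> i j. R $ i $ j + c k * A k $ i $ j)"
  have "det (\<chi> i j. R' $ i $ j + (\<Sum>k\<in>K. c k * A k $ i $ j)) \<noteq> 0"
    using insert.prems insert.hyps by (simp add: R'_def add.assoc)
  then obtain y x where yx: "y \<in> F" "\<And>k. k \<in> K \<Longrightarrow> x k \<in> F"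
    and det: "det (\<chi> i j. y * R' $ i $ j + (\<Sum>k\<in>K. x k * A k $ i $ j)) \<noteq> 0"
    using insert.IH by blast
  \<comment> \<open>Now only the term at \<open>k\<close>, with coefficient \<open>y * c k\<close>,
    can lie outside the pencil over \<open>F\<close>; everything else goes into
    \<open>Q\<close>.\<close>
  define Q where "Q = (\<chi> i j. y * R $ i $ j + (\<Sum>k\<in>K. x k * A k $ i $ j))"
  have "det (\<chi> i j. (y * c k) * A k $ i $ j + Q $ i $ j) \<noteq> 0"
    using det by (simp add: Q_def R'_def algebra_simps)
  then obtain z w where zw: "z \<in> F" "w \<in> F"
    and det': "det (\<chi> i j. z * A k $ i $ j + w * Q $ i $ j) \<noteq> 0"
    using pencil_det_nonzero_in_subset[of F "y * c k" "A k" Q] F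
    unfolding is_subfield_def by blast
  \<comment> \<open>Scaling \<open>Q\<close> by \<open>w\<close> also scales the coefficients
    already found.\<close>
  define x' where "x' = (\<lambda>l. if l = k then z else w * x l)"
  have "(\<Sum>l\<in>K. x' l * A l $ i $ j) = w * (\<Sum>l\<in>K. x l * A l $ i $ j)" for i j
    unfolding sum_distrib_left using insert.hyps
    by (intro sum.cong) (auto simp: x'_def mult.assoc)
  then have "(w * y) * R $ i $ j + (\<Sum>l\<in>insert k K. x' l * A l $ i $ j)
      = z * A k $ i $ j + w * Q $ i $ j" for i j
    using insert.hyps by (simp add: Q_def x'_def algebra_simps)
  with det' have "det (\<chi> i j. (w * y) * R $ i $ j + (\<Sum>l\<in>insert k K. x' l * A l $ i $ j)) \<noteq> 0"
    by simp
  moreover have "w * y \<in> F" "\<forall>l\<in>insert k K. x' l \<in> F"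
    using F(1) yx zw by (auto simp: is_subfield_def x'_def)
  ultimately show ?case by blast
qed

theorem theorem10:
  fixes F :: "'e::field set"
    and C :: "('e \<Rightarrow> 'e) \<Rightarrow> 'e^'d^'d"
  assumes "finite_galois_extension F"
    and "one_cocycle (Gal F) C"
    and "infinite F \<or> CARD('d) \<le> card F"
  shows "\<exists>l. invertible (Pi_map (Gal F) C (mat l))"
proof -
  have ext: "finite_extension F" and sub: "is_subfield F"
    using assms(1) by (auto simp: finite_galois_extension_def finite_extension_def)
  have fin: "finite (Gal F)" using ext by (rule finite_Gal)
  obtain n :: nat and c b where cb:
    "\<And>\<alpha>. \<alpha> \<in> Gal F \<Longrightarrow> (\<Sum>k<n. c k * \<alpha> (b k)) = (if \<alpha> = id then 1 else 0)"
    by (rule separating_functional[OF fin Gal_automorphism id_in_Gal]) blast+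
  define A where "A k = Pi_map (Gal F) C (mat (b k))" for k
  have Pi_entry: "Pi_map (Gal F) C (mat l) $ i $ j = (\<Sum>\<alpha>\<in>Gal F. C \<alpha> $ i $ j * \<alpha> l)" for l i j
    by (simp add: Pi_map_scalar[OF order_refl])
  have comb: "(\<Sum>k<n. z k * A k $ i $ j) = (\<Sum>\<alpha>\<in>Gal F. C \<alpha> $ i $ j * (\<Sum>k<n. z k * \<alpha> (b k)))"
    for z i j
    unfolding A_def Pi_entry sum_distrib_left
    by (subst sum.swap) (simp add: mult_ac)
  have "(\<Sum>k<n. c k * A k $ i $ j) = C id $ i $ j" for i j
  proof -
    have "(\<Sum>k<n. c k * A k $ i $ j) = (\<Sum>\<alpha>\<in>Gal F. if \<alpha> = id then C \<alpha> $ i $ j else 0)"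
      unfolding comb by (intro sum.cong) (auto simp: cb)
    then show ?thesis using fin by (simp add: id_in_Gal)
  qed
  \<comment> \<open>The remainder starts at 0, as every term has a coefficient to be moved into
    \<open>F\<close>.\<close>
  then have "det (\<chi> i j. (0 :: 'e^'d^'d) $ i $ j + (\<Sum>k<n. c k * A k $ i $ j)) = det (C id)"
    by simp
  also have "\<dots> \<noteq> 0"
    using assms(2) id_in_Gal by (auto simp: one_cocycle_def invertible_det_nz)
  finally obtain y x where x: "\<And>k. k < n \<Longrightarrow> x k \<in> F"
    and "det (\<chi> i j. y * (0 :: 'e^'d^'d) $ i $ j + (\<Sum>k<n. x k * A k $ i $ j)) \<noteq> 0"
    using det_combination_nonzero_in_subfield[OF sub assms(3) finite_lessThan, of 0] by blast
  then have det: "det (\<chi> i j. \<Sum>k<n. x k * A k $ i $ j) \<noteq> 0" by simp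
  \<comment> \<open>Elements of \<open>Gal F\<close> fix each \<open>x k\<close>, so the combination
    of the \<open>A k\<close> is the image of one scalar matrix.\<close>
  define l where "l = (\<Sum>k<n. x k * b k)"
  have "(\<Sum>k<n. x k * A k $ i $ j) = Pi_map (Gal F) C (mat l) $ i $ j" for i j
    unfolding comb Pi_entry
  proof (rule sum.cong[OF refl])
    fix \<alpha> assume "\<alpha> \<in> Gal F"
    then have "\<alpha> l = (\<Sum>k<n. x k * \<alpha> (b k))"
      unfolding l_def by (rule Gal_linear_combination) (use x in simp)
    then show "C \<alpha> $ i $ j * (\<Sum>k<n. x k * \<alpha> (b k)) = C \<alpha> $ i $ j * \<alpha> l" by simp
  qed
  with det have "det (Pi_map (Gal F) C (mat l)) \<noteq> 0"
    by simp
  then show ?thesis by (auto simp: invertible_det_nz)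
qed

end
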